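(* Let $R$ be a commutative ring and $M$ an $R$-module, and equip $q\mathrm{Spec}(M)$ with the developed Zariski topology. (1) If $M$ satisfies the ascending chain condition on quasi-semiprime submodules, then $q\mathrm{Spec}(M)$ is a Noetherian topological space. In particular, the quasi-prime spectrum of every Noetherian module is a Noetherian topological space. (2) If for every submodule $N$ of $M$ there exists a finitely generated submodule $L$ of $N$ such that $\Im(\Omega^M(N))=\Im(\Omega^M(L))$, then $q\mathrm{Spec}(M)$ is a Noetherian topological space. (3) If $R$ satisfies the ascending chain condition on quasi-semiprime ideals, then $q\mathrm{Spec}(M)$ is a Noetherian topological space. In particular, for every module $M$ over a Noetherian ring, $q\mathrm{Spec}(M)$ is a Noetherian topological space.
   Context: All rings are commutative with nonzero identity and all modules are unital. For a submodule $N$ of $M$, $(N:M)=\{r\in R\mid rM\subseteq N\}$. A proper ideal $I$ of a ring is quasi-prime if for all ideals $A,B$, $A\cap B\subseteq I$ implies $A\subseteq I$ or $B\subseteq I$. A proper submodule $N$ of $M$ is quasi-prime if $(N:M)$ is a quasi-prime ideal. $q\mathrm{Spec}(M)$, the quasi-prime spectrum of $M$, is the set of quasi-prime submodules of $M$. A submodule of $M$ is quasi-semiprime if it is an intersection of quasi-prime submodules; a quasi-semiprime ideal is an intersection of quasi-prime ideals. $\Omega^M(N)=\{L\in q\mathrm{Spec}(M)\mid L\supseteq N\}$, and for $Y\subseteq q\mathrm{Spec}(M)$, $\Im(Y)$ is the intersection of all elements of $Y$ (equal to $M$ if $Y=\emptyset$). For a submodule $N$ of $M$, $D(N)=\{L\in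 q\mathrm{Spec}(M)\mid (L:M)\supseteq (N:M)\}$. The developed Zariski topology on $q\mathrm{Spec}(M)$ is the topology whose closed sets are exactly the sets $D(N)$, $N$ a submodule of $M$. A topological space is Noetherian if its open subsets satisfy the ascending chain condition. *)

theory Defs
  imports "HOL-Algebra.Module" "HOL-Algebra.Ring_Divisibility" "HOL-Analysis.Abstract_Topology"
begin

text \<open>Both HOL and HOL-Algebra provide a locale called \<open>module\<close>; the carrier-based one of
  HOL-Algebra is meant throughout, hence the qualified name \<open>Module.module\<close>.\<close>

definition residual :: "('a, 'r) ring_scheme \<Rightarrow> ('a, 'b, 'm) module_scheme \<Rightarrow> 'b set \<Rightarrow> 'a set"
  where "residual R M N = {r \<in> carrier R. \<forall>x\<in>carrier M. r \<odot>\<^bsub>M\<^esub> x \<in> N}"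

definition quasi_prime_ideal :: "('a, 'r) ring_scheme \<Rightarrow> 'a set \<Rightarrow> bool"
  where "quasi_prime_ideal R I \<longleftrightarrow> ideal I R \<and> I \<noteq> carrier R \<and>
    (\<forall>A B. ideal A R \<longrightarrow> ideal B R \<longrightarrow> A \<inter> B \<subseteq> I \<longrightarrow> A \<subseteq> I \<or> B \<subseteq> I)"

definition quasi_prime_submodule ::
    "('a, 'r) ring_scheme \<Rightarrow> ('a, 'b, 'm) module_scheme \<Rightarrow> 'b set \<Rightarrow> bool"
  where "quasi_prime_submodule R M N \<longleftrightarrow>
    submodule N R M \<and> N \<noteq> carrier M \<and> quasi_prime_ideal R (residual R M N)"

definition qSpec :: "('a, 'r) ring_scheme \<Rightarrow> ('a, 'b, 'm) module_scheme \<Rightarrow> 'b set set"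
  where "qSpec R M = {N. quasi_prime_submodule R M N}"

text \<open>Intersecting with the carrier only matters for the empty family, whose intersection is then
  the whole module (respectively the whole ring).\<close>

definition Im_inter :: "('a, 'b, 'm) module_scheme \<Rightarrow> 'b set set \<Rightarrow> 'b set"
  where "Im_inter M Y = carrier M \<inter> \<Inter>Y"

definition quasi_semiprime_submodule ::
    "('a, 'r) ring_scheme \<Rightarrow> ('a, 'b, 'm) module_scheme \<Rightarrow> 'b set \<Rightarrow> bool"
  where "quasi_semiprime_submodule R M N \<longleftrightarrow> (\<exists>Y \<subseteq> qSpec R M. N = Im_inter M Y)"

definition quasi_semiprime_ideal :: "('a, 'r) ring_scheme \<Rightarrow> 'a set \<Rightarrow> bool"
  where "quasi_semiprime_ideal R I \<longleftrightarrow>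
    (\<exists>Y \<subseteq> {J. quasi_prime_ideal R J}. I = carrier R \<inter> \<Inter>Y)"

definition Omega :: "('a, 'r) ring_scheme \<Rightarrow> ('a, 'b, 'm) module_scheme \<Rightarrow> 'b set \<Rightarrow> 'b set set"
  where "Omega R M N = {L \<in> qSpec R M. N \<subseteq> L}"

definition dev_variety ::
    "('a, 'r) ring_scheme \<Rightarrow> ('a, 'b, 'm) module_scheme \<Rightarrow> 'b set \<Rightarrow> 'b set set"
  where "dev_variety R M N = {L \<in> qSpec R M. residual R M N \<subseteq> residual R M L}"

definition developed_zariski ::
    "('a, 'r) ring_scheme \<Rightarrow> ('a, 'b, 'm) module_scheme \<Rightarrow> 'b set topology"
  where "developed_zariski R M =
    topology (\<lambda>U. \<exists>N. submodule N R M \<and> U = qSpec R M - dev_variety R M N)"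

definition satisfies_acc :: "'a set set \<Rightarrow> bool"
  where "satisfies_acc F \<longleftrightarrow>
    (\<forall>C :: nat \<Rightarrow> 'a set. (\<forall>n. C n \<in> F \<and> C n \<subseteq> C (Suc n)) \<longrightarrow> (\<exists>n. \<forall>m\<ge>n. C m = C n))"

definition noetherian_space :: "'a topology \<Rightarrow> bool"
  where "noetherian_space X \<longleftrightarrow> satisfies_acc {U. openin X U}"

definition noetherian_module :: "('a, 'r) ring_scheme \<Rightarrow> ('a, 'b, 'm) module_scheme \<Rightarrow> bool"
  where "noetherian_module R M \<longleftrightarrow> Module.module R M \<and> satisfies_acc {N. submodule N R M}"

definition fin_gen_submodule ::
    "('a, 'r) ring_scheme \<Rightarrow> ('a, 'b, 'm) module_scheme \<Rightarrow> 'b set \<Rightarrow> bool"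
  where "fin_gen_submodule R M L \<longleftrightarrow>
    (\<exists>A \<subseteq> carrier M. finite A \<and> L = (\<lambda>K. submodule K R M) hull A)"


text \<open>The remaining lemmas justify the use of \<^const>\<open>topology\<close> in the definition of
  \<^const>\<open>developed_zariski\<close>: its closed sets are exactly the sets \<open>dev_variety R M N\<close>.\<close>

lemma submodule_Inter:
  assumes M: "Module.module R M" and ne: "F \<noteq> {}" and F: "\<And>N. N \<in> F \<Longrightarrow> submodule N R M"
  shows "submodule (\<Inter>F) R M"
proof -
  interpret Module.module R M by (rule M)
  note E = submoduleE[OF F]
  show ?thesis
  proof (rule submoduleI)
    show "\<Inter>F \<subseteq> carrier M" using ne E(1) by blast
    show "\<zero>\<^bsub>M\<^esub> \<in> \<Inter>F"
      using subgroup.one_closed[OF submodule.axioms(1)[OF F]] by auto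
  qed (use E(3-5) in auto)
qed

lemma submodule_hull:
  assumes M: "Module.module R M" and A: "A \<subseteq> carrier M"
  shows "submodule ((\<lambda>K. submodule K R M) hull A) R M"
  unfolding hull_def
  by (rule submodule_Inter[OF M]) (use A Module.module.carrier_is_submodule[OF M] in auto)

lemma residual_mono: "N \<subseteq> L \<Longrightarrow> residual R M N \<subseteq> residual R M L"
  unfolding residual_def by auto

lemma residual_Int: "residual R M (N \<inter> N') = residual R M N \<inter> residual R M N'"
  unfolding residual_def by auto

lemma ideal_residual:
  assumes M: "Module.module R M" and N: "submodule N R M"
  shows "ideal (residual R M N) R"
proof -
  interpret Module.module R M by (rule M)
  note E = submoduleE[OF N]
  have z: "\<zero>\<^bsub>M\<^esub> \<in> N" using subgroup.one_closed[OF submodule.axioms(1)[OF N]] by simp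
  have rl: "a \<otimes>\<^bsub>R\<^esub> x \<in> residual R M N"
    if "a \<in> residual R M N" "x \<in> carrier R" for a x
    using that by (auto simp: residual_def smult_assoc1)
  show ?thesis
  proof (rule idealI)
    show "ring R" by (rule R.ring_axioms)
    show "subgroup (residual R M N) (add_monoid R)"
    proof (rule R.add.subgroupI)
      show "residual R M N \<subseteq> carrier R" by (auto simp: residual_def)
      have "\<zero>\<^bsub>R\<^esub> \<in> residual R M N" using z by (simp add: residual_def)
      then show "residual R M N \<noteq> {}" by blast
    next
      fix a assume "a \<in> residual R M N"
      then show "\<ominus>\<^bsub>R\<^esub> a \<in> residual R M N"
        using E(3) by (simp add: residual_def smult_l_minus)
    next
      fix a b assume "a \<in> residual R M N" "b \<in> residual R M N"
      then show "a \<oplus>\<^bsub>R\<^esub> b \<in> residual R M N"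
        using E(5) by (simp add: residual_def smult_l_distr)
    qed
    show "a \<otimes>\<^bsub>R\<^esub> x \<in> residual R M N" if "a \<in> residual R M N" "x \<in> carrier R" for a x
      using rl that .
    show "x \<otimes>\<^bsub>R\<^esub> a \<in> residual R M N" if "a \<in> residual R M N" "x \<in> carrier R" for a x
      using rl[OF that] that by (simp add: residual_def R.m_comm)
  qed
qed

lemma dev_variety_Int:
  assumes M: "Module.module R M" and N: "submodule N R M" and N': "submodule N' R M"
  shows "dev_variety R M (N \<inter> N') = dev_variety R M N \<union> dev_variety R M N'"
  using ideal_residual[OF M N] ideal_residual[OF M N']
  unfolding dev_variety_def qSpec_def quasi_prime_submodule_def quasi_prime_ideal_def residual_Int
  by blast

lemma dev_variety_Inter:
  assumes M: "Module.module R M" and F: "\<And>N. N \<in> F \<Longrightarrow> submodule N R M"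
  shows "\<exists>K. submodule K R M \<and> dev_variety R M K = qSpec R M \<inter> (\<Inter>N\<in>F. dev_variety R M N)"
proof -
  define A where "A = {r \<odot>\<^bsub>M\<^esub> x |r x. x \<in> carrier M \<and> (\<exists>N\<in>F. r \<in> residual R M N)}"
  define K where "K = (\<lambda>K. submodule K R M) hull A"
  have A: "A \<subseteq> carrier M"
    using Module.module.smult_closed[OF M] unfolding A_def residual_def by auto
  have K: "submodule K R M" unfolding K_def by (rule submodule_hull[OF M A])
  have AK: "A \<subseteq> K" unfolding K_def by (rule hull_subset)
  have NK: "residual R M N \<subseteq> residual R M K" if "N \<in> F" for N
  proof
    fix r assume r: "r \<in> residual R M N"
    have "r \<odot>\<^bsub>M\<^esub> x \<in> K" if "x \<in> carrier M" for x
      using AK r that \<open>N \<in> F\<close> unfolding A_def by blast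
    then show "r \<in> residual R M K" using r by (simp add: residual_def)
  qed
  have KL: "residual R M K \<subseteq> residual R M L"
    if L: "L \<in> qSpec R M" and "\<And>N. N \<in> F \<Longrightarrow> residual R M N \<subseteq> residual R M L" for L
  proof -
    have "A \<subseteq> L" using that(2) unfolding A_def residual_def by blast
    moreover have "submodule L R M" using L by (simp add: qSpec_def quasi_prime_submodule_def)
    ultimately have "K \<subseteq> L" unfolding K_def by (rule hull_minimal)
    then show ?thesis by (rule residual_mono)
  qed
  have "dev_variety R M K = qSpec R M \<inter> (\<Inter>N\<in>F. dev_variety R M N)"
    using NK KL unfolding dev_variety_def by fast
  with K show ?thesis by blast
qed

lemma istopology_developed_zariski:
  assumes M: "Module.module R M"
  shows "istopology (\<lambda>U. \<exists>N. submodule N R M \<and> U = qSpec R M - dev_variety R M N)"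
proof -
  let ?P = "\<lambda>U N. submodule N R M \<and> U = qSpec R M - dev_variety R M N"
  have "\<exists>N. ?P (U \<inter> V) N" if "\<exists>N. ?P U N" "\<exists>N. ?P V N" for U V
  proof -
    from that obtain N N' where NN': "?P U N" "?P V N'" by blast
    have "submodule (\<Inter>{N, N'}) R M"
      by (rule submodule_Inter[OF M]) (use NN' in auto)
    then have "?P (U \<inter> V) (N \<inter> N')" using NN' dev_variety_Int[OF M, of N N'] by auto
    then show ?thesis by blast
  qed
  moreover have "\<exists>N. ?P (\<Union>\<U>) N" if "\<forall>U\<in>\<U>. \<exists>N. ?P U N" for \<U>
  proof -
    from that obtain f where f: "\<And>U. U \<in> \<U> \<Longrightarrow> ?P U (f U)" by metis
    obtain K where K: "submodule K R M"
      "dev_variety R M K = qSpec R M \<inter> (\<Inter>N\<in>f ` \<U>. dev_variety R M N)"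
      using dev_variety_Inter[OF M, of "f ` \<U>"] f by blast
    have "\<Union>\<U> = (\<Union>U\<in>\<U>. qSpec R M - dev_variety R M (f U))" using f by blast
    also have "\<dots> = qSpec R M - dev_variety R M K" using K(2) by auto
    finally show ?thesis using K(1) by blast
  qed
  ultimately show ?thesis unfolding istopology_def by blast
qed

lemma openin_developed_zariski:
  assumes "Module.module R M"
  shows "openin (developed_zariski R M) U \<longleftrightarrow>
    (\<exists>N. submodule N R M \<and> U = qSpec R M - dev_variety R M N)"
  unfolding developed_zariski_def
  by (simp add: topology_inverse'[OF istopology_developed_zariski[OF assms]])

lemma topspace_developed_zariski:
  assumes M: "Module.module R M"
  shows "topspace (developed_zariski R M) = qSpec R M"
proof -
  have "residual R M (carrier M) = carrier R"
    using Module.module.smult_closed[OF M] unfolding residual_def by auto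
  moreover have "residual R M L \<noteq> carrier R" "residual R M L \<subseteq> carrier R" if "L \<in> qSpec R M" for L
    using that by (auto simp: qSpec_def quasi_prime_submodule_def quasi_prime_ideal_def residual_def)
  ultimately have "dev_variety R M (carrier M) = {}" unfolding dev_variety_def by blast
  then have "openin (developed_zariski R M) (qSpec R M)"
    using Module.module.carrier_is_submodule[OF M] by (auto simp: openin_developed_zariski[OF M])
  moreover have "topspace (developed_zariski R M) \<subseteq> qSpec R M"
    unfolding topspace_def openin_developed_zariski[OF M] by blast
  ultimately show ?thesis using openin_subset by blast
qed

lemma closedin_developed_zariski:
  assumes M: "Module.module R M"
  shows "closedin (developed_zariski R M) Y \<longleftrightarrow> (\<exists>N. submodule N R M \<and> Y = dev_variety R M N)"
proof -
  have "dev_variety R M N \<subseteq> qSpec R M" for N unfolding dev_variety_def by blast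
  then show ?thesis
    unfolding closedin_def topspace_developed_zariski[OF M] openin_developed_zariski[OF M] by blast
qed

end

theory Submission
  imports Defs
begin

text \<open>A closed set of the developed Zariski topology is recovered from the intersection \<open>Z\<close> of its
  members, as \<open>D(N) = D(Z)\<close>, and even from the ideal \<open>(Z : M)\<close>. So a descending chain of closed sets
  yields ascending chains of quasi-semiprime submodules \<open>Z\<close> and of quasi-semiprime ideals \<open>(Z : M)\<close>,
  and the stabilisation of either one stabilises the closed sets. For (2), the hypothesis applied to
  the union of an ascending chain of quasi-semiprime submodules shows that the chain stabilises.\<close>

lemma satisfies_acc_mono: "satisfies_acc G \<Longrightarrow> F \<subseteq> G \<Longrightarrow> satisfies_acc F"
  unfolding satisfies_acc_def by blast

lemma Im_inter_antimono: "Y \<subseteq> Z \<Longrightarrow> Im_inter M Z \<subseteq> Im_inter M Y"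
  unfolding Im_inter_def by blast

text \<open>A scalar maps \<open>M\<close> into an intersection iff it maps \<open>M\<close> into
  every member. The factor \<open>carrier R\<close> is the value for empty \<open>Y\<close>, so
  quasi-semiprime submodules get quasi-semiprime ideals as residuals.\<close>

lemma residual_Im_inter:
  assumes "Module.module R M"
  shows "residual R M (Im_inter M Y) = carrier R \<inter> \<Inter>(residual R M ` Y)"
  using Module.module.smult_closed[OF assms] unfolding residual_def Im_inter_def by auto

lemma submodule_Im_inter:
  assumes M: "Module.module R M" and Y: "Y \<subseteq> qSpec R M"
  shows "submodule (Im_inter M Y) R M"
proof -
  \<comment> \<open>Inserting \<open>carrier M\<close> makes the family nonempty, as
    \<open>submodule_Inter\<close> requires, and its intersection is
    \<open>Im_inter M Y\<close>.\<close>
  have "submodule (\<Inter>(insert (carrier M) Y)) R M"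
    by (rule submodule_Inter[OF M])
      (use Y Module.module.carrier_is_submodule[OF M] in
        \<open>auto simp: qSpec_def quasi_prime_submodule_def\<close>)
  then show ?thesis by (simp add: Im_inter_def)
qed

lemma submodule_quasi_semiprime_submodule:
  assumes "Module.module R M" "quasi_semiprime_submodule R M N"
  shows "submodule N R M"
  using assms submodule_Im_inter[OF assms(1)] unfolding quasi_semiprime_submodule_def by blast

text \<open>Let \<open>Z\<close> be the intersection of the members of \<open>D(N)\<close>. All
  their residuals contain \<open>(N : M)\<close>, hence so does \<open>(Z : M)\<close>, and
  \<open>D(Z)\<close> lies in \<open>D(N)\<close>. Conversely, each member of \<open>D(N)\<close>
  contains \<open>Z\<close>, so its residual contains \<open>(Z : M)\<close>.\<close>

lemma dev_variety_Im_inter_dev_variety: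
  assumes M: "Module.module R M"
  shows "dev_variety R M (Im_inter M (dev_variety R M N)) = dev_variety R M N"
proof -
  have "residual R M N \<subseteq> carrier R" by (auto simp: residual_def)
  then show ?thesis
    unfolding dev_variety_def residual_Im_inter[OF M] by blast
qed

text \<open>A family of quasi-prime submodules with intersection \<open>N\<close> is contained in
  \<open>Omega R M N\<close>, whose members all contain \<open>N\<close>.\<close>

lemma Im_inter_Omega_quasi_semiprime:
  assumes "quasi_semiprime_submodule R M N"
  shows "Im_inter M (Omega R M N) = N"
  using assms unfolding quasi_semiprime_submodule_def Omega_def Im_inter_def by blast

text \<open>The common engine of (1) and (3): an inclusion-reversing \<open>f\<close>, injective on
  closed sets, turns an ascending chain of open sets into an ascending chain in \<open>F\<close>,
  and carries its stabilisation back.\<close>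

lemma noetherian_space_developed_zariskiI:
  fixes M :: "('a, 'b, 'm) module_scheme"
  assumes M: "Module.module R M" and acc: "satisfies_acc F"
    and F: "\<And>N. submodule N R M \<Longrightarrow> f (dev_variety R M N) \<in> F"
    and antimono: "\<And>Y Z. Y \<subseteq> Z \<Longrightarrow> f Z \<subseteq> f Y"
    and inj: "\<And>N N'. f (dev_variety R M N) = f (dev_variety R M N') \<Longrightarrow>
      dev_variety R M N = dev_variety R M N'"
  shows "noetherian_space (developed_zariski R M)"
  unfolding noetherian_space_def satisfies_acc_def
proof (intro allI impI)
  fix U :: "nat \<Rightarrow> 'b set set"
  assume U: "\<forall>n. U n \<in> {U. openin (developed_zariski R M) U} \<and> U n \<subseteq> U (Suc n)"
  have "\<exists>N. submodule N R M \<and> U n = qSpec R M - dev_variety R M N" for n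
    using U[rule_format, of n] unfolding openin_developed_zariski[OF M] by simp
  then obtain N where "\<forall>n. submodule (N n) R M \<and> U n = qSpec R M - dev_variety R M (N n)"
    using choice[of "\<lambda>n N. submodule N R M \<and> U n = qSpec R M - dev_variety R M N"] by fast
  then have N: "submodule (N n) R M" "U n = qSpec R M - dev_variety R M (N n)" for n
    by simp_all
  define D where "D n = dev_variety R M (N n)" for n
  have UD: "U n = qSpec R M - D n" for n using N(2) by (simp add: D_def)
  \<comment> \<open>Passing to complements reverses inclusions here because every \<open>D n\<close>
    lies in \<open>qSpec R M\<close>.\<close>
  have "D (Suc n) \<subseteq> D n" for n
  proof -
    have "D (Suc n) \<subseteq> qSpec R M" by (auto simp: D_def dev_variety_def)
    moreover have "qSpec R M - D n \<subseteq> qSpec R M - D (Suc n)" using U by (simp flip: UD)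
    ultimately show ?thesis by blast
  qed
  then have "f (D n) \<subseteq> f (D (Suc n))" for n by (rule antimono)
  moreover have "f (D n) \<in> F" for n unfolding D_def by (rule F[OF N(1)])
  ultimately have "\<exists>n. \<forall>m\<ge>n. f (D m) = f (D n)"
    using acc[unfolded satisfies_acc_def, THEN spec, of "\<lambda>n. f (D n)"] by simp
  then obtain n where n: "f (D m) = f (D n)" if "m \<ge> n" for m by blast
  have "U m = U n" if "m \<ge> n" for m
  proof -
    have "D m = D n" using n[OF that] unfolding D_def by (rule inj)
    then show ?thesis by (simp only: UD)
  qed
  then show "\<exists>n. \<forall>m\<ge>n. U m = U n" by blast
qed

lemma noetherian_space_if_acc_quasi_semiprime_submodule:
  assumes M: "Module.module R M" and acc: "satisfies_acc {N. quasi_semiprime_submodule R M N}"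
  shows "noetherian_space (developed_zariski R M)"
proof (rule noetherian_space_developed_zariskiI[OF M acc, where f = "Im_inter M"])
  show "Im_inter M (dev_variety R M N) \<in> {N. quasi_semiprime_submodule R M N}" for N
    by (auto simp: quasi_semiprime_submodule_def dev_variety_def
        intro!: exI[of _ "dev_variety R M N"])
  show "dev_variety R M N = dev_variety R M N'"
    if "Im_inter M (dev_variety R M N) = Im_inter M (dev_variety R M N')" for N N'
    using arg_cong[OF that, of "dev_variety R M"] unfolding dev_variety_Im_inter_dev_variety[OF M] .
qed (rule Im_inter_antimono)

lemma noetherian_space_if_acc_quasi_semiprime_ideal:
  assumes M: "Module.module R M" and acc: "satisfies_acc {I. quasi_semiprime_ideal R I}"
  shows "noetherian_space (developed_zariski R M)"
proof (rule noetherian_space_developed_zariskiI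
    [OF M acc, where f = "\<lambda>Y. residual R M (Im_inter M Y)"])
  show "residual R M (Im_inter M (dev_variety R M N)) \<in> {I. quasi_semiprime_ideal R I}" for N
  proof -
    have "residual R M ` dev_variety R M N \<subseteq> {J. quasi_prime_ideal R J}"
      by (auto simp: dev_variety_def qSpec_def quasi_prime_submodule_def)
    then show ?thesis
      unfolding residual_Im_inter[OF M] quasi_semiprime_ideal_def
      by (intro CollectI exI[of _ "residual R M ` dev_variety R M N"] conjI refl)
  qed
  show "residual R M (Im_inter M Z) \<subseteq> residual R M (Im_inter M Y)" if "Y \<subseteq> Z" for Y Z
    using that by (intro residual_mono Im_inter_antimono)
  show "dev_variety R M N = dev_variety R M N'"
    if "residual R M (Im_inter M (dev_variety R M N)) = residual R M (Im_inter M (dev_variety R M N'))"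
    for N N'
  proof -
    \<comment> \<open>\<open>dev_variety\<close> depends on its submodule only through the residual.
      The instantiated definition unfolds just the outer occurrence, which exposes the residuals
      assumed equal.\<close>
    have "dev_variety R M (Im_inter M (dev_variety R M N)) =
        dev_variety R M (Im_inter M (dev_variety R M N'))"
      using that by (simp add: dev_variety_def[of R M "Im_inter M _"])
    then show ?thesis unfolding dev_variety_Im_inter_dev_variety[OF M] .
  qed
qed

lemma incseq_eq_if_Union_subset:
  assumes "incseq C" "(\<Union>n. C n) \<subseteq> C k" "k \<le> m"
  shows "C m = C k"
proof
  show "C m \<subseteq> C k" using assms(2) by (simp add: UN_subset_iff)
  show "C k \<subseteq> C m" using assms(1,3) by (rule incseqD)
qed

text \<open>Puts a sequence into the form that \<open>finite_subset_Union_chain\<close> and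
  \<open>ideal_chain_is_trivial\<close> expect.\<close>

lemma subset_chain_range_incseq:
  assumes "incseq C" "range C \<subseteq> F"
  shows "subset.chain F (range C)"
proof -
  have "C m \<subseteq> C n \<or> C n \<subseteq> C m" for m n
    using incseqD[OF assms(1)] nat_le_linear by blast
  then show ?thesis using assms(2) unfolding subset_chain_def by blast
qed

lemma submodule_Union_chain:
  fixes C :: "nat \<Rightarrow> 'b set"
  assumes M: "Module.module R M" and C: "\<And>n. submodule (C n) R M" and "incseq C"
  shows "submodule (\<Union>n. C n) R M"
proof -
  interpret Module.module R M by (rule M)
  note E = submoduleE[OF C]
  show ?thesis
  proof (rule submoduleI)
    show "(\<Union>n. C n) \<subseteq> carrier M" using E(1) by blast
    show "\<zero>\<^bsub>M\<^esub> \<in> (\<Union>n. C n)"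
      using subgroup.one_closed[OF submodule.axioms(1)[OF C]] by auto
  next
    fix a b assume "a \<in> (\<Union>n. C n)" "b \<in> (\<Union>n. C n)"
    then obtain i j where "a \<in> C i" "b \<in> C j" by blast
    \<comment> \<open>Closure under addition needs both summands in a single member of the
      chain.\<close>
    then have "a \<in> C (max i j)" "b \<in> C (max i j)"
      using incseqD[OF \<open>incseq C\<close>] by (meson max.cobounded1 max.cobounded2 subsetD)+
    then show "a \<oplus>\<^bsub>M\<^esub> b \<in> (\<Union>n. C n)" using E(5) by blast
  qed (use E(3,4) in \<open>auto, blast\<close>)
qed

text \<open>The finitely many generators already lie in one member of the chain, and the hull is the
  least submodule containing them.\<close>

lemma fin_gen_submodule_subset_Union_chain:
  fixes C :: "nat \<Rightarrow> 'b set"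
  assumes L: "fin_gen_submodule R M L" "L \<subseteq> (\<Union>n. C n)"
    and C: "\<And>n. submodule (C n) R M" and "incseq C"
  obtains n where "L \<subseteq> C n"
proof -
  obtain A where A: "finite A" "L = (\<lambda>K. submodule K R M) hull A"
    using L(1) unfolding fin_gen_submodule_def by blast
  have "A \<subseteq> L" unfolding A(2) by (rule hull_subset)
  then have "A \<subseteq> (\<Union>n. C n)" using L(2) by (rule order_trans)
  then obtain n where "A \<subseteq> C n"
    using finite_subset_Union_chain[OF A(1) _ _ subset_chain_range_incseq[OF \<open>incseq C\<close> subset_UNIV]]
    by blast
  then have "L \<subseteq> C n" unfolding A(2) using C by (rule hull_minimal)
  then show ?thesis by (rule that)
qed

text \<open>The finitely generated \<open>L\<close> chosen for the union of the chain lies in some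
  \<open>C n\<close>. Since \<open>L\<close> determines the same intersection of quasi-prime
  submodules as the union, and \<open>C n\<close> is its own such intersection, the whole union is
  squeezed into \<open>C n\<close>.\<close>

lemma acc_quasi_semiprime_submodule_if_fin_gen:
  fixes M :: "('a, 'b, 'm) module_scheme"
  assumes M: "Module.module R M"
    and fg: "\<And>N. submodule N R M \<Longrightarrow> \<exists>L. L \<subseteq> N \<and> fin_gen_submodule R M L \<and>
      Im_inter M (Omega R M N) = Im_inter M (Omega R M L)"
  shows "satisfies_acc {N. quasi_semiprime_submodule R M N}"
  unfolding satisfies_acc_def
proof (intro allI impI)
  fix C :: "nat \<Rightarrow> 'b set"
  assume C: "\<forall>n. C n \<in> {N. quasi_semiprime_submodule R M N} \<and> C n \<subseteq> C (Suc n)"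
  then have "incseq C" by (simp add: incseq_SucI)
  have qs: "quasi_semiprime_submodule R M (C n)" for n using C by simp
  note sub = submodule_quasi_semiprime_submodule[OF M qs]
  let ?N = "\<Union>n. C n"
  have N: "submodule ?N R M" by (rule submodule_Union_chain[OF M sub \<open>incseq C\<close>])
  then obtain L where L: "L \<subseteq> ?N" "fin_gen_submodule R M L"
    "Im_inter M (Omega R M ?N) = Im_inter M (Omega R M L)"
    using fg[OF N] by blast
  obtain n where "L \<subseteq> C n"
    using fin_gen_submodule_subset_Union_chain[OF L(2,1) sub \<open>incseq C\<close>] .
  have "?N \<subseteq> Im_inter M (Omega R M ?N)"
    using Module.module.submoduleE(1)[OF M N] by (auto simp: Im_inter_def Omega_def)
  also note L(3)
  also have "Im_inter M (Omega R M L) \<subseteq> Im_inter M (Omega R M (C n))"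
    using \<open>L \<subseteq> C n\<close> by (intro Im_inter_antimono) (auto simp: Omega_def)
  also have "\<dots> = C n" using qs by (rule Im_inter_Omega_quasi_semiprime)
  finally show "\<exists>n. \<forall>m\<ge>n. C m = C n"
    by (intro exI allI impI incseq_eq_if_Union_subset[OF \<open>incseq C\<close>])
qed

lemma (in noetherian_ring) satisfies_acc_ideals: "satisfies_acc {I. ideal I R}"
  unfolding satisfies_acc_def
proof (intro allI impI)
  fix C :: "nat \<Rightarrow> 'a set"
  assume C: "\<forall>n. C n \<in> {I. ideal I R} \<and> C n \<subseteq> C (Suc n)"
  then have inc: "incseq C" by (simp add: incseq_SucI)
  then have "subset.chain {I. ideal I R} (range C)"
    by (rule subset_chain_range_incseq) (use C in blast)
  \<comment> \<open>In a Noetherian ring the union of a nonempty chain of ideals is itself a member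
    of the chain.\<close>
  then obtain n where "\<Union>(range C) = C n" using ideal_chain_is_trivial by blast
  then show "\<exists>n. \<forall>m\<ge>n. C m = C n"
    by (intro exI allI impI incseq_eq_if_Union_subset[OF inc equalityD1])
qed

lemma ideal_quasi_semiprime_ideal:
  assumes "ring R" "quasi_semiprime_ideal R I"
  shows "ideal I R"
proof -
  \<comment> \<open>The inserted \<open>carrier R\<close> gives \<open>i_Intersect\<close> a
    nonempty family even when \<open>Y\<close> is empty.\<close>
  obtain Y where Y: "Y \<subseteq> {J. quasi_prime_ideal R J}" "I = \<Inter>(insert (carrier R) Y)"
    using assms(2) unfolding quasi_semiprime_ideal_def by auto
  show ?thesis unfolding Y(2)
    by (rule ring.i_Intersect[OF assms(1)])
      (use Y(1) ring.oneideal[OF assms(1)] in \<open>auto simp: quasi_prime_ideal_def\<close>)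
qed

theorem theorem3p19:
  fixes R :: "('a, 'r) ring_scheme" and M :: "('a, 'b, 'm) module_scheme"
  assumes "Module.module R M" and "\<one>\<^bsub>R\<^esub> \<noteq> \<zero>\<^bsub>R\<^esub>"
  shows "((satisfies_acc {N. quasi_semiprime_submodule R M N}
            \<longrightarrow> noetherian_space (developed_zariski R M))
          \<and> (noetherian_module R M \<longrightarrow> noetherian_space (developed_zariski R M)))
       \<and> ((\<forall>N. submodule N R M \<longrightarrow>
              (\<exists>L. submodule L R M \<and> L \<subseteq> N \<and> fin_gen_submodule R M L \<and>
                   Im_inter M (Omega R M N) = Im_inter M (Omega R M L)))
            \<longrightarrow> noetherian_space (developed_zariski R M))
       \<and> ((satisfies_acc {I. quasi_semiprime_ideal R I}
            \<longrightarrow> noetherian_space (developed_zariski R M))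
          \<and> (noetherian_ring R \<longrightarrow> noetherian_space (developed_zariski R M)))"
proof (intro conjI impI)
  note M = assms(1)
  show "noetherian_space (developed_zariski R M)"
    if "satisfies_acc {N. quasi_semiprime_submodule R M N}"
    using M that by (rule noetherian_space_if_acc_quasi_semiprime_submodule)
  show "noetherian_space (developed_zariski R M)" if "noetherian_module R M"
  proof (rule noetherian_space_if_acc_quasi_semiprime_submodule[OF M satisfies_acc_mono])
    show "satisfies_acc {N. submodule N R M}" using that by (simp add: noetherian_module_def)
    show "{N. quasi_semiprime_submodule R M N} \<subseteq> {N. submodule N R M}"
      using submodule_quasi_semiprime_submodule[OF M] by blast
  qed
  show "noetherian_space (developed_zariski R M)"
    if "\<forall>N. submodule N R M \<longrightarrow> (\<exists>L. submodule L R M \<and> L \<subseteq> N \<and> fin_gen_submodule R M L \<and>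
      Im_inter M (Omega R M N) = Im_inter M (Omega R M L))"
    \<comment> \<open>(2) reduces to (1), as its hypothesis implies the chain condition on
      quasi-semiprime submodules.\<close>
    by (rule noetherian_space_if_acc_quasi_semiprime_submodule[OF M],
        rule acc_quasi_semiprime_submodule_if_fin_gen[OF M]) (use that in blast)
  show "noetherian_space (developed_zariski R M)" if "satisfies_acc {I. quasi_semiprime_ideal R I}"
    using M that by (rule noetherian_space_if_acc_quasi_semiprime_ideal)
  show "noetherian_space (developed_zariski R M)" if R: "noetherian_ring R"
  proof (rule noetherian_space_if_acc_quasi_semiprime_ideal[OF M satisfies_acc_mono])
    show "satisfies_acc {I. ideal I R}" by (rule noetherian_ring.satisfies_acc_ideals[OF R])
    show "{I. quasi_semiprime_ideal R I} \<subseteq> {I. ideal I R}"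
      using ideal_quasi_semiprime_ideal noetherian_ring.axioms(1)[OF R] by blast
  qed
qed

end
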